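(* Let $p\in\mathbb Z$ be a prime number and let $f:M\to N$ be a homomorphism of abelian groups. Then $f$ is divisible by $p$ (that is, $f=p\cdot g$ for some homomorphism $g:M\to N$) if and only if $f$ is seemingly divisible by $p$.
   Context: A homomorphism $f:M\to N$ of abelian groups is called seemingly divisible by $p$ if for every $m\in M$ there is $n\in N$ with $f(m)=pn$, and $f(m)=0$ for every $m\in M$ with $pm=0$. *)

theory Defs
  imports "HOL-Algebra.Group" "HOL-Computational_Algebra.Primes"
begin

text \<open>
  Abelian groups are the library's \<^locale>\<open>comm_group\<close>, written multiplicatively: the additive
  multiple \<open>p n\<close> is the integer power \<open>n [^] p\<close>, and \<open>0\<close> is \<open>\<one>\<close>. Functions between groups matter
  on the carrier only, so the equation \<open>f = p g\<close> is required on the carrier of \<open>M\<close>.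
\<close>

definition hom_divisible_by ::
    "('a, 'm) monoid_scheme \<Rightarrow> ('b, 'n) monoid_scheme \<Rightarrow> int \<Rightarrow> ('a \<Rightarrow> 'b) \<Rightarrow> bool" where
  "hom_divisible_by M N p f \<longleftrightarrow>
     (\<exists>g \<in> hom M N. \<forall>m \<in> carrier M. f m = g m [^]\<^bsub>N\<^esub> p)"

definition hom_seemingly_divisible_by ::
    "('a, 'm) monoid_scheme \<Rightarrow> ('b, 'n) monoid_scheme \<Rightarrow> int \<Rightarrow> ('a \<Rightarrow> 'b) \<Rightarrow> bool" where
  "hom_seemingly_divisible_by M N p f \<longleftrightarrow>
     (\<forall>m \<in> carrier M. \<exists>n \<in> carrier N. f m = n [^]\<^bsub>N\<^esub> p) \<and>
     (\<forall>m \<in> carrier M. m [^]\<^bsub>M\<^esub> p = \<one>\<^bsub>M\<^esub> \<longrightarrow> f m = \<one>\<^bsub>N\<^esub>)"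

end

theory Submission
  imports Defs "HOL-Algebra.Generated_Groups"
begin

text \<open>
  A homomorphism \<open>g\<close> with \<open>f = p g\<close> has to send \<open>p m\<close> to \<open>f m\<close>. Since \<open>f\<close> kills the \<open>p\<close>-torsion, this
  prescribes a homomorphism on \<open>p M\<close>, and by Zorn's lemma it has a maximal extension to a subgroup
  \<open>H\<close> of \<open>M\<close>. If \<open>x \<notin> H\<close>, then \<open>k x \<in> H\<close> only for \<open>p\<close> dividing \<open>k\<close>, because \<open>p x \<in> H\<close> and \<open>p\<close> is
  prime; hence the extension can be enlarged by sending \<open>x\<close> to any \<open>n\<close> with \<open>p n = f x\<close>. So \<open>H = M\<close>.
  Partial homomorphisms are represented by their graphs, the subgroups of \<open>M \<times>\<times> N\<close> meeting
  \<open>\<one> \<times> N\<close> trivially.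
\<close>

text \<open>Any two elements of the union already lie in a common member, the larger of two
  comparable subgroups. This provides the upper bounds for Zorn's lemma.\<close>

lemma (in group) subgroup_Union_chain:
  assumes "\<C> \<noteq> {}" and "subset.chain {H. subgroup H G} \<C>"
  shows "subgroup (\<Union>\<C>) G"
proof (rule subgroupI)
  have sub: "subgroup H G" if "H \<in> \<C>" for H
    using assms that by (auto simp: subset_chain_def)
  show "\<Union>\<C> \<subseteq> carrier G" using sub subgroup.subset by blast
  show "\<Union>\<C> \<noteq> {}" using assms(1) sub subgroup.one_closed by fastforce
  show "inv a \<in> \<Union>\<C>" if "a \<in> \<Union>\<C>" for a
    using that sub subgroup.m_inv_closed by fastforce
  show "a \<otimes> b \<in> \<Union>\<C>" if ab: "a \<in> \<Union>\<C>" "b \<in> \<Union>\<C>" for a b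
  proof -
    obtain A B where AB: "A \<in> \<C>" "a \<in> A" "B \<in> \<C>" "b \<in> B" using ab by blast
    then have "A \<subseteq> B \<or> B \<subseteq> A" using assms(2) by (auto simp: subset_chain_def)
    then show ?thesis using AB sub subgroup.m_closed by (metis UnionI subsetD)
  qed
qed

text \<open>Commutativity lets the powers of \<open>x\<close> be collected, so these products
  already form the subgroup generated by \<open>H\<close> and \<open>x\<close>. The explicit form
  exposes the exponent \<open>k\<close>.\<close>

lemma (in comm_group) subgroup_adjoin:
  assumes H: "subgroup H G" and x: "x \<in> carrier G"
  shows "subgroup {h \<otimes> x [^] k | h (k :: int). h \<in> H} G"
proof (rule subgroupI)
  interpret H: subgroup H G by fact
  let ?S = "{h \<otimes> x [^] k | h (k :: int). h \<in> H}"
  show "?S \<subseteq> carrier G" using x by auto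
  show "?S \<noteq> {}" using H.one_closed by blast
  show "inv a \<in> ?S" if a_in: "a \<in> ?S" for a
  proof -
    obtain h and k :: int where a: "a = h \<otimes> x [^] k" "h \<in> H" using a_in by blast
    then have "inv a = inv h \<otimes> x [^] (- k)" using x by (simp add: inv_mult int_pow_neg)
    then show ?thesis using a by blast
  qed
  show "a \<otimes> b \<in> ?S" if ab: "a \<in> ?S" "b \<in> ?S" for a b
  proof -
    obtain h h' and k k' :: int where
      h: "a = h \<otimes> x [^] k" "h \<in> H" "b = h' \<otimes> x [^] k'" "h' \<in> H" using ab by blast
    then have "a \<otimes> b = (h \<otimes> h') \<otimes> x [^] (k + k')" using x by (simp add: int_pow_mult m_ac)
    then show ?thesis using h by blast
  qed
qed

text \<open>The exponents \<open>k\<close> with \<open>x [^] k \<in> H\<close> form an ideal of the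
  integers. It contains \<open>p\<close> but not 1, so by Bezout every member is a multiple of the
  prime \<open>p\<close>.\<close>

lemma (in group) prime_dvd_of_int_pow_mem:
  fixes p k :: int
  assumes H: "subgroup H G" and x: "x \<in> carrier G" "x \<notin> H"
    and p: "prime p" "x [^] p \<in> H" and k: "x [^] k \<in> H"
  shows "p dvd k"
proof (rule ccontr)
  assume "\<not> p dvd k"
  then have "coprime p k" using p by (simp add: prime_imp_coprime)
  then obtain u v where uv: "p * u + k * v = 1" by (metis bezout_int coprime_imp_gcd_eq_1 mult.commute)
  have "(x [^] p) [^] u \<otimes> (x [^] k) [^] v \<in> H"
    using H p k by (simp add: subgroup_int_pow_closed subgroup.m_closed)
  also have "(x [^] p) [^] u \<otimes> (x [^] k) [^] v = x [^] (p * u + k * v)"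
    using x by (simp add: int_pow_pow int_pow_mult)
  finally show False using x uv by simp
qed

lemma int_pow_DirProd:
  fixes k :: int
  assumes "group M" "group N" "a \<in> carrier M" "b \<in> carrier N"
  shows "(a, b) [^]\<^bsub>M \<times>\<times> N\<^esub> k = (a [^]\<^bsub>M\<^esub> k, b [^]\<^bsub>N\<^esub> k)"
proof -
  have P: "group (M \<times>\<times> N)" and ab: "(a, b) \<in> carrier (M \<times>\<times> N)"
    using assms by (simp_all add: DirProd_group)
  \<comment> \<open>Both projections are homomorphisms and so commute with integer powers.\<close>
  have "fst \<in> hom (M \<times>\<times> N) M" "snd \<in> hom (M \<times>\<times> N) N" by (auto simp: hom_def)
  from this[THEN hom_int_pow, OF ab P] show ?thesis
    using assms by (simp add: prod_eq_iff)
qed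

lemma comm_group_DirProd:
  assumes "comm_group M" "comm_group N"
  shows "comm_group (M \<times>\<times> N)"
proof -
  interpret M: comm_group M by fact
  interpret N: comm_group N by fact
  show ?thesis
    by (rule group.group_comm_groupI[OF DirProd_group])
      (auto simp: M.m_comm N.m_comm M.is_group N.is_group)
qed

text \<open>The quotient of two pairs of \<open>G\<close> with the same first component lies over
  the identity, so \<open>ker\<close> makes \<open>G\<close> single-valued. Closure of
  \<open>G\<close> under products is then multiplicativity of the function.\<close>

lemma graph_imp_hom:
  assumes "group M" "group N"
    and G: "subgroup G (M \<times>\<times> N)"
    and dom: "carrier M \<subseteq> fst ` G"
    and ker: "\<And>n. (\<one>\<^bsub>M\<^esub>, n) \<in> G \<Longrightarrow> n = \<one>\<^bsub>N\<^esub>"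
  obtains g where "g \<in> hom M N" and "\<And>m n. (m, n) \<in> G \<longleftrightarrow> m \<in> carrier M \<and> n = g m"
proof -
  interpret M: group M by fact
  interpret N: group N by fact
  interpret G: subgroup G "M \<times>\<times> N" by fact
  have carr: "m \<in> carrier M" "n \<in> carrier N" if "(m, n) \<in> G" for m n
    using G.subset that by auto
  have unique: "n = n'" if "(m, n) \<in> G" "(m, n') \<in> G" for m n n'
  proof -
    have "(m, n) \<otimes>\<^bsub>M \<times>\<times> N\<^esub> inv\<^bsub>M \<times>\<times> N\<^esub> (m, n') \<in> G" using that by blast
    then have "n \<otimes>\<^bsub>N\<^esub> inv\<^bsub>N\<^esub> n' = \<one>\<^bsub>N\<^esub>"
      using that carr ker by (simp add: assms)
    then show ?thesis using carr that by (metis N.inv_equality N.inv_inv N.inv_closed)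
  qed
  define g where "g m = (THE n. (m, n) \<in> G)" for m
  have g: "(m, n) \<in> G \<longleftrightarrow> m \<in> carrier M \<and> n = g m" for m n
  proof -
    have "g m = n" if "(m, n) \<in> G" for m n
      unfolding g_def using that unique by blast
    then show ?thesis using dom carr by fastforce
  qed
  have "g \<in> hom M N"
  proof (rule homI)
    fix a b assume ab: "a \<in> carrier M" "b \<in> carrier M"
    then have G_ab: "(a, g a) \<in> G" "(b, g b) \<in> G" using g by auto
    then show "g a \<in> carrier N" using carr by blast
    show "g (a \<otimes>\<^bsub>M\<^esub> b) = g a \<otimes>\<^bsub>N\<^esub> g b"
      using G.m_closed[OF G_ab] g by simp
  qed
  with g that show thesis by blast
qed

lemma hom_along_prime_multiple:
  fixes p :: int
  assumes p: "prime p" and "comm_group M" "comm_group N" and f: "f \<in> hom M N"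
    and root: "\<And>m. m \<in> carrier M \<Longrightarrow> \<exists>n \<in> carrier N. f m = n [^]\<^bsub>N\<^esub> p"
    and tors: "\<And>m. m \<in> carrier M \<Longrightarrow> m [^]\<^bsub>M\<^esub> p = \<one>\<^bsub>M\<^esub> \<Longrightarrow> f m = \<one>\<^bsub>N\<^esub>"
  obtains g where "g \<in> hom M N" and "\<And>m. m \<in> carrier M \<Longrightarrow> g (m [^]\<^bsub>M\<^esub> p) = f m"
proof -
  interpret M: comm_group M by fact
  interpret N: comm_group N by fact
  interpret P: comm_group "M \<times>\<times> N" using assms by (simp add: comm_group_DirProd)
  \<comment> \<open>\<open>G0\<close> is the graph of the prescribed map on the \<open>p\<close>-th
    powers of \<open>M\<close>, obtained as the image of a homomorphism from \<open>M\<close>;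
    \<open>\<A>\<close> collects the partial homomorphisms extending it.\<close>
  define G0 where "G0 = (\<lambda>m. (m [^]\<^bsub>M\<^esub> p, f m)) ` carrier M"
  define \<A> where "\<A> = {G. subgroup G (M \<times>\<times> N) \<and> G0 \<subseteq> G \<and> (\<forall>n. (\<one>\<^bsub>M\<^esub>, n) \<in> G \<longrightarrow> n = \<one>\<^bsub>N\<^esub>)}"
  have "(\<lambda>m. (m [^]\<^bsub>M\<^esub> p, f m)) \<in> hom M (M \<times>\<times> N)"
    using f by (simp add: hom_paired) (simp add: hom_def M.int_pow_distrib)
  then interpret q: group_hom M "M \<times>\<times> N" "\<lambda>m. (m [^]\<^bsub>M\<^esub> p, f m)"
    by unfold_locales
  have "subgroup G0 (M \<times>\<times> N)" unfolding G0_def by (rule q.img_is_subgroup)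
  \<comment> \<open>A pair of \<open>G0\<close> over the identity comes from a
    \<open>p\<close>-torsion element, which \<open>f\<close> kills.\<close>
  moreover have "n = \<one>\<^bsub>N\<^esub>" if "(\<one>\<^bsub>M\<^esub>, n) \<in> G0" for n
    using that tors by (auto simp: G0_def)
  ultimately have "\<A> \<noteq> {}" unfolding \<A>_def by blast
  moreover have "\<Union>\<C> \<in> \<A>" if "\<C> \<noteq> {}" "subset.chain \<A> \<C>" for \<C>
  proof -
    have "subset.chain {H. subgroup H (M \<times>\<times> N)} \<C>"
      using that(2) by (auto simp: subset_chain_def \<A>_def)
    then have "subgroup (\<Union>\<C>) (M \<times>\<times> N)" by (rule P.subgroup_Union_chain[OF that(1)])
    moreover have "\<C> \<subseteq> \<A>" using that(2) by (simp add: subset_chain_def)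
    ultimately show ?thesis using that(1) unfolding \<A>_def by blast
  qed
  ultimately obtain G where "G \<in> \<A>" and max: "\<And>X. X \<in> \<A> \<Longrightarrow> G \<subseteq> X \<Longrightarrow> X = G"
    using subset_Zorn_nonempty[of \<A>] by blast
  then have G: "subgroup G (M \<times>\<times> N)" and G0: "G0 \<subseteq> G"
    and ker: "\<And>n. (\<one>\<^bsub>M\<^esub>, n) \<in> G \<Longrightarrow> n = \<one>\<^bsub>N\<^esub>" by (auto simp: \<A>_def)
  interpret G: subgroup G "M \<times>\<times> N" by fact
  have "x \<in> fst ` G" if x: "x \<in> carrier M" for x
  proof (rule ccontr)
    assume x_notin: "x \<notin> fst ` G"
    obtain n where n: "n \<in> carrier N" "f x = n [^]\<^bsub>N\<^esub> p" using root x by blast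
    have pow: "(x, n) [^]\<^bsub>M \<times>\<times> N\<^esub> k = (x [^]\<^bsub>M\<^esub> k, n [^]\<^bsub>N\<^esub> k)" for k :: int
      using x n by (simp add: int_pow_DirProd)
    have xn: "(x, n) \<in> carrier (M \<times>\<times> N)" using x n by simp
    \<comment> \<open>By the choice of \<open>n\<close>, this power is
      \<open>(x [^] p, f x)\<close>, an element of \<open>G0\<close>.\<close>
    have xn_p: "(x, n) [^]\<^bsub>M \<times>\<times> N\<^esub> p \<in> G"
      using G0 x n pow by (auto simp: G0_def)
    have "fst \<in> hom (M \<times>\<times> N) M" by (auto simp: hom_def)
    then interpret fst: group_hom "M \<times>\<times> N" M fst by unfold_locales
    have dom: "subgroup (fst ` G) M" by (rule fst.subgroup_img_is_subgroup[OF G])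
    \<comment> \<open>The candidate extension sends \<open>x\<close> to \<open>n\<close>.\<close>
    define G' where "G' = {h \<otimes>\<^bsub>M \<times>\<times> N\<^esub> (x, n) [^]\<^bsub>M \<times>\<times> N\<^esub> k | h (k :: int). h \<in> G}"
    have G': "subgroup G' (M \<times>\<times> N)" unfolding G'_def by (rule P.subgroup_adjoin[OF G xn])
    have "h \<in> G'" if "h \<in> G" for h
    proof -
      have "h = h \<otimes>\<^bsub>M \<times>\<times> N\<^esub> (x, n) [^]\<^bsub>M \<times>\<times> N\<^esub> (0::int)"
        using G.mem_carrier[OF that] by (simp del: one_DirProd)
      then show ?thesis using that unfolding G'_def by blast
    qed
    then have "G \<subseteq> G'" by blast
    \<comment> \<open>The extension stays single-valued: first components put \<open>x [^] k\<close>
      into the domain of \<open>G\<close>, so \<open>p\<close> divides \<open>k\<close>. Then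
      \<open>(x, n) [^] k\<close> is a power of an element of \<open>G\<close>, hence
      \<open>(\<one>, b)\<close> lies in \<open>G\<close>, where \<open>ker\<close> applies.\<close>
    moreover have "b = \<one>\<^bsub>N\<^esub>" if b: "(\<one>\<^bsub>M\<^esub>, b) \<in> G'" for b
    proof -
      obtain h and k :: int where
        h: "h \<in> G" and hk: "(\<one>\<^bsub>M\<^esub>, b) = h \<otimes>\<^bsub>M \<times>\<times> N\<^esub> (x, n) [^]\<^bsub>M \<times>\<times> N\<^esub> k"
        using b unfolding G'_def by blast
      then have "\<one>\<^bsub>M\<^esub> = fst h \<otimes>\<^bsub>M\<^esub> x [^]\<^bsub>M\<^esub> k" by (simp add: mult_DirProd' pow)
      moreover have h_M: "fst h \<in> carrier M" using G.mem_carrier[OF h] by auto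
      ultimately have "x [^]\<^bsub>M\<^esub> k = inv\<^bsub>M\<^esub> (fst h)"
        using x by (metis M.inv_equality M.inv_inv M.int_pow_closed)
      then have "x [^]\<^bsub>M\<^esub> k \<in> fst ` G" using h subgroup.m_inv_closed[OF dom] by simp
      moreover have "x [^]\<^bsub>M\<^esub> p \<in> fst ` G" using xn_p unfolding pow by force
      ultimately have "p dvd k" using M.prime_dvd_of_int_pow_mem[OF dom x x_notin p] by blast
      then obtain l where "k = p * l" by blast
      then have "(x, n) [^]\<^bsub>M \<times>\<times> N\<^esub> k = ((x, n) [^]\<^bsub>M \<times>\<times> N\<^esub> p) [^]\<^bsub>M \<times>\<times> N\<^esub> l"
        using P.int_pow_pow[OF xn] by simp
      then have "(x, n) [^]\<^bsub>M \<times>\<times> N\<^esub> k \<in> G" using P.subgroup_int_pow_closed[OF G xn_p] by simp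
      then show ?thesis using hk h ker by simp
    qed
    ultimately have "G' \<in> \<A>" using G' G0 unfolding \<A>_def by blast
    then have "G' = G" using max \<open>G \<subseteq> G'\<close> by blast
    moreover have "(x, n) \<in> G'"
    proof -
      have "(x, n) = \<one>\<^bsub>M \<times>\<times> N\<^esub> \<otimes>\<^bsub>M \<times>\<times> N\<^esub> (x, n) [^]\<^bsub>M \<times>\<times> N\<^esub> (1::int)"
        using x n by (simp add: pow)
      then show ?thesis unfolding G'_def using G.one_closed by blast
    qed
    ultimately show False using x_notin by force
  qed
  then have total: "carrier M \<subseteq> fst ` G" by blast
  obtain g where g: "g \<in> hom M N" "\<And>m n. (m, n) \<in> G \<longleftrightarrow> m \<in> carrier M \<and> n = g m"
    using graph_imp_hom[OF M.is_group N.is_group G total ker] by blast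
  have "g (m [^]\<^bsub>M\<^esub> p) = f m" if "m \<in> carrier M" for m
  proof -
    have "(m [^]\<^bsub>M\<^esub> p, f m) \<in> G" using G0 that by (auto simp: G0_def)
    then show ?thesis using g(2) by simp
  qed
  with g(1) that show thesis by blast
qed

theorem proposition1p2:
  fixes M :: "('a, 'm) monoid_scheme" and N :: "('b, 'n) monoid_scheme"
    and f :: "'a \<Rightarrow> 'b" and p :: int
  assumes "prime p"
    and "comm_group M" and "comm_group N"
    and "f \<in> hom M N"
  shows "hom_divisible_by M N p f \<longleftrightarrow> hom_seemingly_divisible_by M N p f"
proof -
  interpret M: comm_group M by fact
  interpret N: comm_group N by fact
  have pow: "g (m [^]\<^bsub>M\<^esub> p) = g m [^]\<^bsub>N\<^esub> p" if "g \<in> hom M N" "m \<in> carrier M" for g m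
    using that by (simp add: hom_int_pow)
  show ?thesis
  proof
    assume "hom_divisible_by M N p f"
    then obtain g where g: "g \<in> hom M N" "\<And>m. m \<in> carrier M \<Longrightarrow> f m = g m [^]\<^bsub>N\<^esub> p"
      unfolding hom_divisible_by_def by blast
    \<comment> \<open>Here \<open>f m = g m [^] p = g (m [^] p) = g \<one> = \<one>\<close>.\<close>
    have "f m = \<one>\<^bsub>N\<^esub>" if "m \<in> carrier M" "m [^]\<^bsub>M\<^esub> p = \<one>\<^bsub>M\<^esub>" for m
      using that g pow[OF g(1)] hom_one[OF g(1) M.is_group N.is_group] by metis
    then show "hom_seemingly_divisible_by M N p f"
      unfolding hom_seemingly_divisible_by_def using g hom_in_carrier by metis
  next
    assume "hom_seemingly_divisible_by M N p f"
    then obtain g where g: "g \<in> hom M N" "\<And>m. m \<in> carrier M \<Longrightarrow> g (m [^]\<^bsub>M\<^esub> p) = f m"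
      unfolding hom_seemingly_divisible_by_def
      using hom_along_prime_multiple[OF assms] by metis
    \<comment> \<open>A homomorphism commutes with powers, so prescribing \<open>g\<close> on
      \<open>p\<close>-th powers amounts to \<open>f m = g m [^] p\<close>.\<close>
    then show "hom_divisible_by M N p f"
      unfolding hom_divisible_by_def using pow[OF g(1)] by metis
  qed
qed

end
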